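(* Let $d\ge 2$ be an integer such that $d+1$ is a prime. Let $G$ be a $d$-degenerate graph and let $L$ be a list assignment for $G$ with $|L(v)|\ge d+1$ for all $v\in V(G)$. If $r$ is a request for $G$ with $L$ and $|\mathrm{dom}(r)|=1$, then $r$ is $1$-satisfiable.
   Context: Graphs are finite and simple. A graph $G$ is $d$-degenerate if every (non-null) subgraph of $G$ has a vertex of degree at most $d$. A list assignment $L$ for $G$ assigns to each vertex $v\in V(G)$ a finite set $L(v)$ of colors; an $L$-coloring is a proper coloring $\phi$ of $G$ with $\phi(v)\in L(v)$ for all $v\in V(G)$. A request for $G$ with $L$ is a function $r$ with domain $\mathrm{dom}(r)\subseteq V(G)$ such that $r(v)\in L(v)$ for all $v\in\mathrm{dom}(r)$. For $\varepsilon>0$, a request $r$ is $\varepsilon$-satisfiable if there exists an $L$-coloring $\phi$ of $G$ such that $\phi(v)=r(v)$ for at least $\varepsilon|\mathrm{dom}(r)|$ vertices $v\in\mathrm{dom}(r)$. *)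

theory Defs
  imports
    Complex_Main
    "HOL-Computational_Algebra.Primes"
    "Graph_Theory.Graph_Theory"
begin

text \<open>
  A finite simple graph is a \<^locale>\<open>pair_graph\<close>: a finite vertex set with a symmetric irreflexive
  set of arcs, the edge uv being represented by both arcs (u, v) and (v, u). Accordingly the
  degree of a vertex is its out-degree, and the subgraphs in the undirected sense are the
  subdigraphs that are again symmetric.
\<close>

definition degenerate :: "nat \<Rightarrow> 'a pair_pre_digraph \<Rightarrow> bool" where
  "degenerate d G \<longleftrightarrow>
     (\<forall>H. pair_graph H \<and> subgraph (with_proj H) (with_proj G) \<and> pverts H \<noteq> {} \<longrightarrow>
        (\<exists>v\<in>pverts H. out_degree (with_proj H) v \<le> d))"

definition list_assignment :: "'a pair_pre_digraph \<Rightarrow> ('a \<Rightarrow> 'c set) \<Rightarrow> bool" where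
  "list_assignment G L \<longleftrightarrow> (\<forall>v\<in>pverts G. finite (L v))"

text \<open>Colorings are total functions; their values outside the vertex set are irrelevant.\<close>

definition list_coloring :: "'a pair_pre_digraph \<Rightarrow> ('a \<Rightarrow> 'c set) \<Rightarrow> ('a \<Rightarrow> 'c) \<Rightarrow> bool" where
  "list_coloring G L \<phi> \<longleftrightarrow>
     (\<forall>v\<in>pverts G. \<phi> v \<in> L v) \<and> (\<forall>(u, v)\<in>parcs G. \<phi> u \<noteq> \<phi> v)"

definition request :: "'a pair_pre_digraph \<Rightarrow> ('a \<Rightarrow> 'c set) \<Rightarrow> ('a \<rightharpoonup> 'c) \<Rightarrow> bool" where
  "request G L r \<longleftrightarrow> dom r \<subseteq> pverts G \<and> (\<forall>v\<in>dom r. the (r v) \<in> L v)"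

definition satisfiable_request ::
  "real \<Rightarrow> 'a pair_pre_digraph \<Rightarrow> ('a \<Rightarrow> 'c set) \<Rightarrow> ('a \<rightharpoonup> 'c) \<Rightarrow> bool" where
  "satisfiable_request \<epsilon> G L r \<longleftrightarrow>
     (\<exists>\<phi>. list_coloring G L \<phi> \<and>
          real (card {v \<in> dom r. \<phi> v = the (r v)}) \<ge> \<epsilon> * real (card (dom r)))"

end

theory Submission
  imports Defs "HOL-Library.FuncSet"
begin

text \<open>
  Let \<open>p = d + 1\<close> and let \<open>P\<close> be the product of \<open>x\<^sub>u - x\<^sub>v\<close> over the edges. A degeneracy order yields
  a monomial of coefficient 1 in \<open>P\<close> with all exponents at most \<open>d\<close>. As \<open>P\<close> is translation invariant,
  the sum of its partial derivatives vanishes, and modulo \<open>p\<close> differentiation never brings an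
  exponent \<open>p\<close> down to \<open>d\<close>. Hence among the monomials with exponents at most \<open>d\<close> whose coefficient is
  nonzero modulo \<open>p\<close> there is one in which the variable of the requested vertex does not occur.
  By the Combinatorial Nullstellensatz the list of that vertex may then be shrunk to the requested
  colour.
\<close>

section \<open>Coefficients of the graph polynomial\<close>

text \<open>
  The coefficient of \<open>x\<^sup>m\<close> in the product of \<open>x\<^sub>u - x\<^sub>v\<close> over the list. Exponents are integers, so
  that no case distinction for zero exponents is needed; coefficients with a negative exponent
  vanish.
\<close>

primrec gcoeff :: "('a \<times> 'a) list \<Rightarrow> ('a \<Rightarrow> int) \<Rightarrow> int" where
  "gcoeff [] m = (if m = (\<lambda>_. 0) then 1 else 0)"
| "gcoeff (e # E) m =
     gcoeff E (m(fst e := m (fst e) - 1)) - gcoeff E (m(snd e := m (snd e) - 1))"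

lemma gcoeff_nonneg:
  assumes "gcoeff E m \<noteq> 0"
  shows "0 \<le> m i"
  using assms
proof (induction E arbitrary: m)
  case Nil
  then show ?case by (auto split: if_splits)
next
  case (Cons e E)
  then consider "gcoeff E (m(fst e := m (fst e) - 1)) \<noteq> 0"
    | "gcoeff E (m(snd e := m (snd e) - 1)) \<noteq> 0"
    by fastforce
  then show ?case
    by cases (drule Cons.IH, simp split: if_splits)+
qed

lemma gcoeff_le_degree:
  assumes "gcoeff E m \<noteq> 0"
  shows "m w \<le> int (length (filter (\<lambda>e. fst e = w \<or> snd e = w) E))"
  using assms
proof (induction E arbitrary: m)
  case Nil
  then show ?case by (auto split: if_splits)
next
  case (Cons e E)
  then consider "gcoeff E (m(fst e := m (fst e) - 1)) \<noteq> 0"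
    | "gcoeff E (m(snd e := m (snd e) - 1)) \<noteq> 0"
    by fastforce
  then show ?case
    by cases (drule Cons.IH, auto split: if_splits)+
qed

text \<open>Homogeneity: each of the \<open>length E\<close> factors contributes one variable, and
  that variable lies in \<open>V\<close>.\<close>

lemma gcoeff_sum_exponents:
  assumes "finite V" "set E \<subseteq> V \<times> V" "gcoeff E m \<noteq> 0"
  shows "sum m V = int (length E)"
  using assms(2,3)
proof (induction E arbitrary: m)
  case Nil
  then show ?case by (auto split: if_splits)
next
  case (Cons e E)
  have *: "sum (m(u := m u - 1)) V = sum m V - 1" if "u \<in> V" for u
    using \<open>finite V\<close> that by (simp add: sum.remove)
  have "fst e \<in> V" "snd e \<in> V" using Cons.prems by auto
  moreover from Cons.prems consider "gcoeff E (m(fst e := m (fst e) - 1)) \<noteq> 0"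
    | "gcoeff E (m(snd e := m (snd e) - 1)) \<noteq> 0"
    by fastforce
  ultimately show ?case
    using Cons.IH Cons.prems(1) by cases (simp_all add: * del: fun_upd_apply, (smt (verit) *)+)
qed

text \<open>The coefficient of \<open>x^m\<close> in the \<open>i\<close>-th partial derivative is
  the \<open>i\<close>-th summand. The sum of all partial derivatives is a derivation that
  annihilates every factor \<open>x_u - x_v\<close>, hence the whole product.\<close>

lemma gcoeff_derivative:
  assumes "finite V" "set E \<subseteq> V \<times> V"
  shows "(\<Sum>i\<in>V. (m i + 1) * gcoeff E (m(i := m i + 1))) = 0"
  using assms(2)
proof (induction E arbitrary: m)
  case Nil
  \<comment> \<open>For the constant 1 the shifted coefficient is nonzero only if
    \<open>m i = -1\<close>, and there the factor \<open>m i + 1\<close> is zero.\<close>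
  have "m i + 1 = 0" if "m(i := m i + 1) = (\<lambda>_. 0)" for i
    using fun_cong[OF that, of i] by simp
  then show ?case by (intro sum.neutral ballI) (simp del: fun_upd_apply)
next
  case (Cons e E)
  \<comment> \<open>Product rule for \<open>x_u Q\<close>, with \<open>Q\<close> the product over
    \<open>E\<close>: the part in which \<open>Q\<close> is differentiated vanishes by induction,
    and the coefficient of \<open>Q\<close> remains. It does not depend on \<open>u\<close>, so the
    two ends of \<open>e\<close> cancel.\<close>
  have *: "(\<Sum>i\<in>V. (m i + 1) * gcoeff E ((m(i := m i + 1))(u := (m(i := m i + 1)) u - 1)))
    = gcoeff E m" if "u \<in> V" for u
  proof -
    let ?m = "m(u := m u - 1)"
    have "(\<Sum>i\<in>V. (m i + 1) * gcoeff E ((m(i := m i + 1))(u := (m(i := m i + 1)) u - 1)))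
      = (\<Sum>i\<in>V. (?m i + 1) * gcoeff E (?m(i := ?m i + 1)) + (if i = u then gcoeff E m else 0))"
      by (intro sum.cong refl) (auto simp: fun_upd_twist algebra_simps)
    also have "\<dots> = (\<Sum>i\<in>V. (?m i + 1) * gcoeff E (?m(i := ?m i + 1))) + gcoeff E m"
      using \<open>finite V\<close> that by (simp add: sum.distrib del: fun_upd_apply)
    also have "\<dots> = gcoeff E m" using Cons.IH[of ?m] Cons.prems by (simp del: fun_upd_apply)
    finally show ?thesis .
  qed
  have "fst e \<in> V" "snd e \<in> V" using Cons.prems by auto
  then show ?case
    using *[of "fst e"] *[of "snd e"]
    by (simp add: right_diff_distrib sum_subtractf del: fun_upd_apply)
qed

text \<open>Descent on the exponent of \<open>v\<close>: if it is positive, the derivative identity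
  yields another coefficient that is nonzero modulo \<open>d + 1\<close>, with all exponents still
  at most \<open>d\<close> and a smaller exponent at \<open>v\<close>.\<close>

lemma gcoeff_eliminate_exponent:
  assumes "finite V" "set E \<subseteq> V \<times> V" "prime (d + 1)" "v \<in> V"
    and "\<forall>i. m i \<le> int d" "\<not> int (d + 1) dvd gcoeff E m"
  shows "\<exists>m'. m' v = 0 \<and> (\<forall>i. m' i \<le> int d) \<and> gcoeff E m' \<noteq> 0"
  using assms(5,6)
proof (induction "nat (m v)" arbitrary: m rule: less_induct)
  case less
  have nz: "gcoeff E m \<noteq> 0" using less.prems by auto
  show ?case
  proof (cases "m v = 0")
    case True
    then show ?thesis using less.prems nz by blast
  next
    case False
    then have pos: "m v > 0" using gcoeff_nonneg[OF nz, of v] by simp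
    \<comment> \<open>In the derivative identity at \<open>n\<close>, the summand for
      \<open>v\<close> is \<open>m v * gcoeff E m\<close>; every other summand has exponent
      \<open>m v - 1\<close> at \<open>v\<close>.\<close>
    define n where "n = m(v := m v - 1)"
    show ?thesis
    proof (rule ccontr)
      assume none: "\<not> ?thesis"
      have "int (d + 1) dvd (n i + 1) * gcoeff E (n(i := n i + 1))" if "i \<in> V - {v}" for i
      \<comment> \<open>Raising an exponent \<open>d\<close> would leave the allowed range, but
        there the factor \<open>n i + 1\<close> is the prime itself. Otherwise the induction
        hypothesis and \<open>none\<close> make the coefficient divisible.\<close>
      proof (cases "m i = int d")
        case True
        then have "n i + 1 = int (d + 1)" using that by (simp add: n_def)
        then show ?thesis by (metis dvd_triv_left)
      next
        case False
        then have le: "\<forall>j. (n(i := n i + 1)) j \<le> int d"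
          using less.prems(1) pos that by (auto simp: n_def intro: order_trans[of _ "m v"])
             (smt (verit) less.prems(1))+
        have "nat ((n(i := n i + 1)) v) < nat (m v)" using that pos by (auto simp: n_def)
        then have "int (d + 1) dvd gcoeff E (n(i := n i + 1))"
          using less.hyps le none by blast
        then show ?thesis by (rule dvd_mult)
      qed
      then have "int (d + 1) dvd (\<Sum>i\<in>V - {v}. (n i + 1) * gcoeff E (n(i := n i + 1)))"
        by (rule dvd_sum)
      moreover have "(n v + 1) * gcoeff E (n(v := n v + 1))
          + (\<Sum>i\<in>V - {v}. (n i + 1) * gcoeff E (n(i := n i + 1))) = 0"
        using gcoeff_derivative[OF assms(1,2), of n]
          sum.remove[OF assms(1,4), of "\<lambda>i. (n i + 1) * gcoeff E (n(i := n i + 1))"]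
        by (simp del: fun_upd_apply)
      moreover have "(n v + 1) * gcoeff E (n(v := n v + 1)) = m v * gcoeff E m"
        by (simp add: n_def)
      \<comment> \<open>So the summand for \<open>v\<close> is divisible too, which contradicts
        \<open>0 < m v < d + 1\<close> together with the choice of \<open>m\<close>.\<close>
      ultimately have "int (d + 1) dvd m v * gcoeff E m"
        by (simp only: add_eq_0_iff2 dvd_minus_iff)
      moreover have "prime (int (d + 1))" using assms(3) by (simp only: prime_nat_int_transfer)
      ultimately have "int (d + 1) dvd m v"
        using less.prems(2) by (metis prime_dvd_mult_iff)
      then have "int (d + 1) \<le> m v" using pos by (rule zdvd_imp_le)
      moreover have "m v \<le> int d" using less.prems(1) by blast
      ultimately show False by simp
    qed
  qed
qed

text \<open>Only the \<open>length ns\<close> new factors contain \<open>x_w\<close>, so the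
  exponent \<open>length ns\<close> is reached only by choosing \<open>x_w\<close> from each of
  them.\<close>

lemma gcoeff_append_star:
  assumes "\<forall>e\<in>set E. fst e \<noteq> w \<and> snd e \<noteq> w" "w \<notin> set ns" "m w = 0"
  shows "gcoeff (map (Pair w) ns @ E) (m(w := int (length ns))) = gcoeff E m"
  using assms(2)
proof (induction ns)
  case Nil
  then show ?case using assms(3) by (simp add: fun_upd_idem)
next
  case (Cons u ns)
  let ?F = "map (Pair w) ns @ E"
  let ?m = "m(w := int (length (u # ns)))"
  \<comment> \<open>Choosing \<open>x_u\<close> from the first factor leaves exponent
    \<open>length ns + 1\<close> at \<open>w\<close>, but only \<open>length ns\<close> of the
    remaining factors contain \<open>x_w\<close>.\<close>
  have "length (filter (\<lambda>e. fst e = w \<or> snd e = w) ?F) = length ns"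
    using assms(1) by (simp add: comp_def filter_empty_conv)
  moreover have "(?m(u := ?m u - 1)) w = int (length ns) + 1" using Cons.prems by simp
  ultimately have "gcoeff ?F (?m(u := ?m u - 1)) = 0"
    using gcoeff_le_degree[of ?F "?m(u := ?m u - 1)" w] by linarith
  moreover have "gcoeff (map (Pair w) (u # ns) @ E) ?m
      = gcoeff ?F (?m(w := ?m w - 1)) - gcoeff ?F (?m(u := ?m u - 1))"
    by (simp del: fun_upd_apply)
  moreover have "?m(w := ?m w - 1) = m(w := int (length ns))" by simp
  moreover have "gcoeff ?F (m(w := int (length ns))) = gcoeff E m"
    by (rule Cons.IH) (use Cons.prems in simp)
  ultimately show ?case by (simp only: diff_0_right)
qed

text \<open>A vertex \<open>w\<close> with at most \<open>d\<close> neighbours in \<open>V\<close>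
  is removed, and its edges are oriented away from it. Giving \<open>w\<close> its degree as
  exponent keeps the coefficient 1. It suffices that each edge occurs in \<open>E\<close> in one
  orientation.\<close>

lemma degenerate_gcoeff:
  assumes "finite V" "sym A" "irrefl A"
    and "\<And>U. U \<subseteq> V \<Longrightarrow> U \<noteq> {} \<Longrightarrow> \<exists>w\<in>U. card {u\<in>U. (w, u) \<in> A} \<le> d"
  shows "\<exists>E m. set E \<subseteq> V \<times> V \<and> A \<inter> V \<times> V \<subseteq> set E \<union> (set E)\<inverse>
    \<and> (\<forall>i. m i \<le> int d) \<and> gcoeff E m = 1"
  using assms(1,4)
proof (induction V rule: finite_psubset_induct)
  case (psubset V)
  show ?case
  proof (cases "V = {}")
    case True
    show ?thesis
      by (rule exI[of _ "[]"], rule exI[of _ "\<lambda>_. 0"]) (simp add: True)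
  next
    case False
    then obtain w where w: "w \<in> V" "card {u\<in>V. (w, u) \<in> A} \<le> d" using psubset.prems by blast
    have "\<exists>E m. set E \<subseteq> (V - {w}) \<times> (V - {w})
      \<and> A \<inter> (V - {w}) \<times> (V - {w}) \<subseteq> set E \<union> (set E)\<inverse>
      \<and> (\<forall>i. m i \<le> int d) \<and> gcoeff E m = 1"
      using w psubset.prems by (intro psubset.IH) auto
    then obtain E m where E: "set E \<subseteq> (V - {w}) \<times> (V - {w})"
      "A \<inter> (V - {w}) \<times> (V - {w}) \<subseteq> set E \<union> (set E)\<inverse>"
      and m: "\<forall>i. m i \<le> int d" "gcoeff E m = 1" by blast
    obtain ns where ns: "set ns = {u\<in>V. (w, u) \<in> A}" "distinct ns"
      using finite_distinct_list[of "{u\<in>V. (w, u) \<in> A}"] psubset.hyps by auto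
    have noinc: "\<forall>e\<in>set E. fst e \<noteq> w \<and> snd e \<noteq> w" using E(1) by auto
    then have "filter (\<lambda>e. fst e = w \<or> snd e = w) E = []" by (simp add: filter_empty_conv)
    then have "m w = 0"
      using gcoeff_le_degree[of E m w] gcoeff_nonneg[of E m w] m(2) by simp
    moreover have "w \<notin> set ns" using ns(1) assms(3) by (auto simp: irrefl_def)
    ultimately have "gcoeff (map (Pair w) ns @ E) (m(w := int (length ns))) = 1"
      using gcoeff_append_star noinc m(2) by metis
    moreover have "length ns \<le> d" using w(2) ns distinct_card by metis
    then have "\<forall>i. (m(w := int (length ns))) i \<le> int d" using m(1) by simp
    moreover have "set (map (Pair w) ns @ E) \<subseteq> V \<times> V" using E(1) ns(1) w(1) by auto
    moreover have "A \<inter> V \<times> V \<subseteq> set (map (Pair w) ns @ E) \<union> (set (map (Pair w) ns @ E))\<inverse>"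
    proof
      fix e assume e: "e \<in> A \<inter> V \<times> V"
      obtain x y where xy: "e = (x, y)" by fastforce
      have "(y, x) \<in> A" using e xy assms(2) by (auto dest: symD)
      then show "e \<in> set (map (Pair w) ns @ E) \<union> (set (map (Pair w) ns @ E))\<inverse>"
        using e xy ns(1) E(2) by (cases "x = w"; cases "y = w") auto
    qed
    ultimately show ?thesis by blast
  qed
qed

section \<open>The Combinatorial Nullstellensatz for graph polynomials\<close>

text \<open>The barycentric weights of Lagrange interpolation: summing
  \<open>node_weight S a * f a\<close> over \<open>S\<close> gives the divided difference of
  \<open>f\<close>, which is the coefficient of degree \<open>card S - 1\<close> for polynomials of
  at most that degree.\<close>

definition node_weight :: "real set \<Rightarrow> real \<Rightarrow> real" where
  "node_weight S a = inverse (\<Prod>b\<in>S - {a}. a - b)"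

lemma node_weight_remove:
  assumes "finite S" "b \<in> S" "a \<noteq> b"
  shows "(a - b) * node_weight S a = node_weight (S - {b}) a"
proof -
  have "(\<Prod>c\<in>S - {a}. a - c) = (a - b) * (\<Prod>c\<in>S - {a} - {b}. a - c)"
    using assms by (intro prod.remove) auto
  moreover have "S - {a} - {b} = S - {b} - {a}" by blast
  ultimately show ?thesis using assms by (simp add: node_weight_def)
qed

lemma sum_node_weight_remove:
  assumes "finite S" "b \<in> S"
  shows "(\<Sum>a\<in>S. (a - b) * node_weight S a) = sum (node_weight (S - {b})) (S - {b})"
  using assms by (simp add: sum.remove[of S b] node_weight_remove)

text \<open>The divided difference of the constant 1. Since
  \<open>a - b = (x - b) - (x - a)\<close>, multiplying it by \<open>a - b\<close> gives the
  difference of the sums for \<open>S - {b}\<close> and \<open>S - {a}\<close>, which agree by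
  induction as these sets have equal size.\<close>

lemma sum_node_weight:
  assumes "finite S" "S \<noteq> {}"
  shows "sum (node_weight S) S = (if card S = 1 then 1 else 0)"
  using assms
proof (induction S rule: finite_psubset_induct)
  case (psubset S)
  show ?case
  proof (cases "card S = 1")
    case True
    then show ?thesis by (auto simp: card_1_singleton_iff node_weight_def)
  next
    case False
    then obtain a b where ab: "a \<in> S" "b \<in> S" "a \<noteq> b"
      using psubset.prems psubset.hyps
      by (metis card_1_singleton_iff is_singletonI' is_singleton_altdef)
    have "(a - b) * sum (node_weight S) S
      = (\<Sum>x\<in>S. (x - b) * node_weight S x) - (\<Sum>x\<in>S. (x - a) * node_weight S x)"
      by (simp add: sum_distrib_left flip: sum_subtractf left_diff_distrib)
    also have "\<dots> = sum (node_weight (S - {b})) (S - {b}) - sum (node_weight (S - {a})) (S - {a})"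
      using psubset.hyps ab by (simp add: sum_node_weight_remove)
    also have "\<dots> = 0"
    proof -
      have "S - {a} \<subset> S" "S - {b} \<subset> S" "S - {a} \<noteq> {}" "S - {b} \<noteq> {}"
        "card (S - {a}) = card (S - {b})"
        using ab psubset.hyps by auto
      then show ?thesis using psubset.IH by simp
    qed
    finally show ?thesis using ab False by simp
  qed
qed

definition edge_product :: "('a \<times> 'a) list \<Rightarrow> ('a \<Rightarrow> real) \<Rightarrow> real" where
  "edge_product E x = (\<Prod>e\<leftarrow>E. x (fst e) - x (snd e))"

text \<open>A divided difference in each variable simultaneously. \<open>PiE\<close> fixes the
  values outside \<open>V\<close>, so each grid point is counted once.\<close>

definition grid_functional :: "'a set \<Rightarrow> ('a \<Rightarrow> real set) \<Rightarrow> (('a \<Rightarrow> real) \<Rightarrow> real) \<Rightarrow> real" where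
  "grid_functional V S f = (\<Sum>x\<in>PiE V S. (\<Prod>i\<in>V. node_weight (S i) (x i)) * f x)"

text \<open>The factor \<open>x u - a\<close> kills the points with \<open>x u = a\<close> and
  cancels a factor of the weight at all others. Deleting a node thus mirrors lowering an exponent in
  \<open>gcoeff\<close>.\<close>

lemma grid_functional_remove:
  assumes "finite V" "\<And>i. i \<in> V \<Longrightarrow> finite (S i)" "u \<in> V" "a \<in> S u"
  shows "grid_functional V S (\<lambda>x. (x u - a) * f x) = grid_functional V (S(u := S u - {a})) f"
proof -
  let ?S = "S(u := S u - {a})"
  have "PiE V ?S = {x \<in> PiE V S. x u \<noteq> a}"
    using assms(3) by (auto simp: PiE_def Pi_def split: if_splits)
  then have "grid_functional V ?S f
    = (\<Sum>x\<in>{x \<in> PiE V S. x u \<noteq> a}. (\<Prod>i\<in>V. node_weight (?S i) (x i)) * f x)"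
    by (simp add: grid_functional_def)
  also have "\<dots> = (\<Sum>x\<in>{x \<in> PiE V S. x u \<noteq> a}.
      (\<Prod>i\<in>V. node_weight (S i) (x i)) * ((x u - a) * f x))"
  proof (rule sum.cong[OF refl])
    fix x assume "x \<in> {x \<in> PiE V S. x u \<noteq> a}"
    then have "(x u - a) * node_weight (S u) (x u) = node_weight (S u - {a}) (x u)"
      using assms by (intro node_weight_remove) auto
    then show "(\<Prod>i\<in>V. node_weight (?S i) (x i)) * f x
      = (\<Prod>i\<in>V. node_weight (S i) (x i)) * ((x u - a) * f x)"
      using assms(1,3) by (simp add: prod.remove[of V u] mult_ac)
  qed
  also have "\<dots> = grid_functional V S (\<lambda>x. (x u - a) * f x)"
    unfolding grid_functional_def
    using assms by (intro sum.mono_neutral_left) (auto intro!: finite_PiE)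
  finally show ?thesis by simp
qed

text \<open>The coefficient formula behind the Combinatorial Nullstellensatz. The degree bound is an
  inequality because the induction also needs the case of too small degree, where both sides
  vanish.\<close>

lemma grid_functional_edge_product:
  assumes "finite V" "set E \<subseteq> V \<times> V" "\<And>i. i \<in> V \<Longrightarrow> finite (S i)"
    and "int (length E) \<le> (\<Sum>i\<in>V. int (card (S i)) - 1)"
  shows "grid_functional V S (edge_product E)
    = of_int (gcoeff E (\<lambda>i. if i \<in> V then int (card (S i)) - 1 else 0))"
  using assms(2-)
proof (induction E arbitrary: S)
  case Nil
  let ?m = "\<lambda>i. if i \<in> V then int (card (S i)) - 1 else 0"
  have "grid_functional V S (edge_product []) = (\<Prod>i\<in>V. sum (node_weight (S i)) (S i))"
    using Nil \<open>finite V\<close> by (simp add: grid_functional_def edge_product_def prod_sum_PiE)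
  also have "\<dots> = (\<Prod>i\<in>V. if card (S i) = 1 then 1 else 0)"
    using Nil by (intro prod.cong refl) (metis card.empty sum.empty sum_node_weight zero_neq_one)
  also have "\<dots> = (if \<forall>i\<in>V. card (S i) = 1 then 1 else 0)"
    using \<open>finite V\<close> by (auto intro!: prod.neutral)
  also have "(\<forall>i\<in>V. card (S i) = 1) \<longleftrightarrow> ?m = (\<lambda>_. 0)"
    by (auto simp: fun_eq_iff)
  finally show ?case by simp
next
  case (Cons e E)
  let ?k = "\<lambda>S i. if i \<in> V then int (card (S i :: real set)) - 1 else 0"
  obtain u v where e: "e = (u, v)" and uv: "u \<in> V" "v \<in> V" using Cons.prems by (cases e) auto
  show ?case
  proof (cases "\<exists>i\<in>V. S i = {}")
    \<comment> \<open>An empty node set empties the grid; it corresponds to the exponent -1, for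
      which the coefficient is 0.\<close>
    case True
    then obtain i where i: "i \<in> V" "S i = {}" by blast
    then have "PiE V S = {}" by (auto simp: PiE_eq_empty_iff)
    moreover have "?k S i = -1" using i by simp
    then have "gcoeff (e # E) (?k S) = 0" using gcoeff_nonneg[of "e # E" "?k S" i] by force
    ultimately show ?thesis by (simp add: grid_functional_def)
  next
    case False
    then obtain a b where ab: "a \<in> S u" "b \<in> S v" using uv by blast
    have rem: "grid_functional V (S(w := S w - {c})) (edge_product E)
        = of_int (gcoeff E ((?k S)(w := ?k S w - 1)))" if w: "w \<in> V" "c \<in> S w" for w c
    proof -
      have "int (card (S w - {c})) = int (card (S w)) - 1"
        using w Cons.prems(2) by (metis card_Suc_Diff1 add_diff_cancel_left' of_nat_Suc)
      then have k: "?k (S(w := S w - {c})) = (?k S)(w := ?k S w - 1)"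
        using w by (auto simp: fun_eq_iff)
      have "(\<Sum>i\<in>V. int (card ((S(w := S w - {c})) i)) - 1)
        = sum (?k (S(w := S w - {c}))) V" by (rule sum.cong) auto
      also have "\<dots> = sum (?k S) V - 1"
        unfolding k using w \<open>finite V\<close> by (simp add: sum.remove)
      also have "sum (?k S) V = (\<Sum>i\<in>V. int (card (S i)) - 1)" by (rule sum.cong) auto
      finally have "int (length E) \<le> (\<Sum>i\<in>V. int (card ((S(w := S w - {c})) i)) - 1)"
        using Cons.prems(3) by simp
      then have "grid_functional V (S(w := S w - {c})) (edge_product E)
          = of_int (gcoeff E (?k (S(w := S w - {c}))))"
        by (intro Cons.IH) (use Cons.prems(1,2) in auto)
      then show ?thesis unfolding k .
    qed
    \<comment> \<open>The exponents sum to at least \<open>length E + 1\<close>, more than the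
      degree of the product over \<open>E\<close>.\<close>
    have "sum (?k S) V = (\<Sum>i\<in>V. int (card (S i)) - 1)" by (rule sum.cong) auto
    then have "gcoeff E (?k S) = 0"
      using gcoeff_sum_exponents[of V E "?k S"] \<open>finite V\<close> Cons.prems by auto
    then have zero: "grid_functional V S (edge_product E) = 0"
      using Cons.IH[of S] Cons.prems by simp
    \<comment> \<open>With nodes \<open>a\<close> and \<open>b\<close>,
      \<open>x u - x v = (x u - a) - (x v - b) + (a - b)\<close>: the first two parts delete a node
      and match the recursion of \<open>gcoeff\<close>, the third vanishes by
      \<open>zero\<close>.\<close>
    have "edge_product (e # E) = (\<lambda>x. (x u - a) * edge_product E x - (x v - b) * edge_product E x
        + (a - b) * edge_product E x)"
      by (rule ext) (simp add: edge_product_def e algebra_simps)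
    then have "grid_functional V S (edge_product (e # E))
      = grid_functional V S (\<lambda>x. (x u - a) * edge_product E x)
        - grid_functional V S (\<lambda>x. (x v - b) * edge_product E x)
        + (a - b) * grid_functional V S (edge_product E)"
      unfolding grid_functional_def
      by (simp add: distrib_left right_diff_distrib sum.distrib sum_subtractf sum_distrib_left mult.left_commute)
    also have "\<dots> = of_int (gcoeff (e # E) (?k S))"
      using ab uv \<open>finite V\<close> Cons.prems(2) e
      by (simp add: grid_functional_remove rem zero del: fun_upd_apply)
    finally show ?thesis .
  qed
qed

text \<open>On a grid with \<open>m i + 1\<close> nodes in direction \<open>i\<close> the functional
  equals the nonzero coefficient, so the edge product is nonzero at some grid point, which is a
  proper colouring.\<close>

lemma gcoeff_list_coloring:
  assumes "finite V" "set E \<subseteq> V \<times> V" "gcoeff E m \<noteq> 0"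
    and "\<And>i. i \<in> V \<Longrightarrow> finite (T i)" "\<And>i. i \<in> V \<Longrightarrow> m i < int (card (T i))"
  shows "\<exists>\<phi>. (\<forall>i\<in>V. \<phi> i \<in> T i) \<and> (\<forall>(u, v)\<in>set E. \<phi> u \<noteq> \<phi> v)"
proof -
  have nonneg: "0 \<le> m i" for i by (rule gcoeff_nonneg[OF assms(3)])
  have "\<exists>R. R \<subseteq> T i \<and> card R = nat (m i) + 1" if "i \<in> V" for i
  proof -
    have "nat (m i) + 1 \<le> card (T i)" using assms(5)[OF that] nonneg[of i] by linarith
    then show ?thesis using obtain_subset_with_card_n by metis
  qed
  then obtain R where R: "\<And>i. i \<in> V \<Longrightarrow> R i \<subseteq> T i \<and> card (R i) = nat (m i) + 1" by metis
  have finR: "finite (R i)" if "i \<in> V" for i using R assms(4) that finite_subset by blast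
  \<comment> \<open>Colours are of arbitrary type; an injection turns the finitely many relevant
    ones into real nodes.\<close>
  have "finite (\<Union>i\<in>V. R i)" using finR assms(1) by blast
  then obtain f :: "_ \<Rightarrow> nat" where f: "inj_on f (\<Union>i\<in>V. R i)"
    using finite_imp_inj_to_nat_seg by metis
  define g where "g = real \<circ> f"
  have g: "inj_on g (\<Union>i\<in>V. R i)" using f by (auto simp: g_def inj_on_def)
  let ?S = "\<lambda>i. g ` R i"
  have card: "int (card (?S i)) - 1 = m i" if "i \<in> V" for i
  proof -
    have "inj_on g (R i)" using g that by (auto intro: inj_on_subset)
    then show ?thesis using R[OF that] nonneg[of i] by (simp add: card_image)
  qed
  \<comment> \<open>No factor contains a variable outside \<open>V\<close>, so \<open>m\<close>
    agrees everywhere with the exponents read off the grid.\<close>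
  have out: "m i = 0" if "i \<notin> V" for i
  proof -
    have "filter (\<lambda>e. fst e = i \<or> snd e = i) E = []"
      using assms(2) that by (auto simp: filter_empty_conv)
    then show ?thesis using gcoeff_le_degree[OF assms(3), of i] nonneg[of i] by simp
  qed
  have "(\<lambda>i. if i \<in> V then int (card (?S i)) - 1 else 0) = m"
    using card out by auto
  moreover have "(\<Sum>i\<in>V. int (card (?S i)) - 1) = int (length E)"
    using gcoeff_sum_exponents[OF assms(1-3)] card by simp
  ultimately have "grid_functional V ?S (edge_product E) \<noteq> 0"
    using grid_functional_edge_product[of V E ?S] assms(1-3) finR by simp
  then have "\<exists>x\<in>PiE V ?S. edge_product E x \<noteq> 0"
    unfolding grid_functional_def by (rule contrapos_np) (auto intro!: sum.neutral)
  then obtain x where x: "x \<in> PiE V ?S" "edge_product E x \<noteq> 0" by blast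
  have "\<forall>i\<in>V. \<exists>c\<in>R i. x i = g c" using x(1) by (auto simp: PiE_iff)
  then obtain \<phi> where \<phi>: "\<forall>i\<in>V. \<phi> i \<in> R i \<and> x i = g (\<phi> i)" by metis
  have "\<phi> u \<noteq> \<phi> v" if "(u, v) \<in> set E" for u v
  proof -
    have "x u \<noteq> x v" using x(2) that by (force simp: edge_product_def prod_list_zero_iff)
    then show ?thesis using \<phi> assms(2) that by auto
  qed
  then show ?thesis using \<phi> R by blast
qed

section \<open>Single requests\<close>

text \<open>Degeneracy applied to the subgraph induced on \<open>U\<close>, where the out-degree
  counts the neighbours inside \<open>U\<close>.\<close>

lemma degenerate_induced:
  assumes "pair_graph G" "degenerate d G" "U \<subseteq> pverts G" "U \<noteq> {}"
  shows "\<exists>w\<in>U. card {u\<in>U. (w, u) \<in> parcs G} \<le> d"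
proof -
  interpret G: pair_graph G by fact
  define H where "H = \<lparr>pverts = U, parcs = parcs G \<inter> U \<times> U\<rparr>"
  have pG: "pair_graph H"
  proof
    show "finite (pverts H)"
      using finite_subset[OF assms(3) G.pair_finite_verts] by (simp add: H_def)
    show "finite (parcs H)" using G.pair_finite_arcs by (simp add: H_def)
    show "symmetric (with_proj H)"
      using G.pair_sym_arcs by (auto simp: H_def symmetric_def sym_def arcs_ends_conv)
  qed (use G.pair_no_loops in \<open>auto simp: H_def\<close>)
  then interpret H: pair_graph H .
  have "subgraph (with_proj H) (with_proj G)"
    using assms(3) G.wf_digraph H.wf_digraph
    by (auto simp: subgraph_def compatible_def H_def)
  moreover have "pverts H = U" by (simp add: H_def)
  ultimately obtain w where w: "w \<in> U" "out_degree (with_proj H) w \<le> d"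
    using pG assms(2,4) unfolding degenerate_def by metis
  have "out_arcs (with_proj H) w = Pair w ` {u\<in>U. (w, u) \<in> parcs G}"
    using w(1) by (auto simp: out_arcs_def H_def)
  then have "out_degree (with_proj H) w = card {u\<in>U. (w, u) \<in> parcs G}"
    by (simp add: out_degree_def card_image inj_on_def)
  then show ?thesis using w by auto
qed

theorem theorem6:
  fixes d :: nat
    and G :: "'a pair_pre_digraph"
    and L :: "'a \<Rightarrow> 'c set"
    and r :: "'a \<rightharpoonup> 'c"
  assumes "d \<ge> 2"
    and "prime (d + 1)"
    and "pair_graph G"
    and "degenerate d G"
    and "list_assignment G L"
    and "\<forall>v\<in>pverts G. card (L v) \<ge> d + 1"
    and "request G L r"
    and "card (dom r) = 1"
  shows "satisfiable_request 1 G L r"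
proof -
  interpret G: pair_graph G by fact
  obtain v where v: "dom r = {v}" using assms(8) card_1_singletonE by blast
  then obtain c where c: "r v = Some c" by blast
  have vc: "v \<in> pverts G" "c \<in> L v" using assms(7) v c by (auto simp: request_def)
  have sym: "sym (parcs G)" using G.pair_sym_arcs by (auto simp: symmetric_def arcs_ends_conv)
  have "irrefl (parcs G)" using G.pair_no_loops by (force simp: irrefl_def)
  then obtain E m where E: "set E \<subseteq> pverts G \<times> pverts G"
    "parcs G \<inter> pverts G \<times> pverts G \<subseteq> set E \<union> (set E)\<inverse>"
    and m: "\<forall>i. m i \<le> int d" "gcoeff E m = 1"
    using degenerate_gcoeff[OF G.pair_finite_verts sym _ degenerate_induced[OF assms(3,4)]]
    by metis
  have "\<not> int (d + 1) dvd gcoeff E m" using assms(1) m(2) by simp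
  then obtain k where k: "k v = 0" "\<forall>i. k i \<le> int d" "gcoeff E k \<noteq> 0"
    using gcoeff_eliminate_exponent[OF G.pair_finite_verts E(1) assms(2) vc(1) m(1)] by blast
  \<comment> \<open>A list of size 1 at \<open>v\<close> forces the requested colour and suffices
    because \<open>k v = 0\<close>; elsewhere \<open>k i \<le> d < card (L i)\<close>.\<close>
  define T where "T = L(v := {c})"
  have "\<exists>\<phi>. (\<forall>i\<in>pverts G. \<phi> i \<in> T i) \<and> (\<forall>(u, w)\<in>set E. \<phi> u \<noteq> \<phi> w)"
  proof (rule gcoeff_list_coloring[OF _ E(1) k(3)])
    show "finite (pverts G)" using G.pair_finite_verts by simp
    show "finite (T i)" if "i \<in> pverts G" for i
      using assms(5) that by (auto simp: T_def list_assignment_def)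
    show "k i < int (card (T i))" if "i \<in> pverts G" for i
    proof (cases "i = v")
      case False
      then have "d < card (T i)" using assms(6) that by (auto simp: T_def)
      then show ?thesis using k(2) by (meson le_less_trans of_nat_less_iff)
    qed (simp add: T_def k(1))
  qed
  then obtain \<phi> where \<phi>: "\<forall>i\<in>pverts G. \<phi> i \<in> T i" "\<forall>(u, w)\<in>set E. \<phi> u \<noteq> \<phi> w" by blast
  have \<phi>v: "\<phi> v = c" using \<phi>(1) vc(1) by (auto simp: T_def)
  have "\<forall>i\<in>pverts G. \<phi> i \<in> L i" using \<phi>(1) vc(2) by (auto simp: T_def split: if_splits)
  moreover have "\<phi> u \<noteq> \<phi> w" if "(u, w) \<in> parcs G" for u w
  proof -
    \<comment> \<open>\<open>E\<close> may hold the edge in the opposite orientation, which is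
      harmless since inequality of colours is symmetric.\<close>
    have "(u, w) \<in> set E \<or> (w, u) \<in> set E"
      using that E(2) G.in_arcsD1 G.in_arcsD2 by blast
    then show ?thesis using \<phi>(2) by auto
  qed
  ultimately have "list_coloring G L \<phi>" by (auto simp: list_coloring_def)
  moreover have "{u \<in> dom r. \<phi> u = the (r u)} = dom r" using v c \<phi>v by auto
  ultimately show ?thesis unfolding satisfiable_request_def by auto
qed

end
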